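(* For every integer $n\ge 3$, $\hat{A}_{\Sigma}(n) \leq 3n-6$.
   Context: For a finite set $\mathcal P \subset \mathbb{R}^2$ and $p \in \mathcal P$, $A_p(\mathcal P)$ denotes the number of distinct values in $(0,\pi)$ of angles $\angle q p r$ with center (vertex) $p$ and $q,r \in \mathcal P\setminus\{p\}$ distinct. Define $$\hat{A}_{\Sigma}(n) := \min_{|\mathcal{P}| = n}\ \sum_{p \in \mathcal P} A_p(\mathcal{P}),$$ where the minimum is over all sets $\mathcal{P}\subset\mathbb{R}^2$ of $n$ points that are not all collinear. *)

theory Defs
  imports "HOL-Analysis.Analysis"
begin

text \<open>The undirected angle \<open>\<angle> q p r\<close> with vertex \<open>p\<close>, a number in \<open>[0, \<pi>]\<close>;
  it is meaningful only if \<open>q \<noteq> p\<close> and \<open>r \<noteq> p\<close>.\<close>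

definition angle_at :: "real ^ 2 \<Rightarrow> real ^ 2 \<Rightarrow> real ^ 2 \<Rightarrow> real" where
  "angle_at q p r = arccos (((q - p) \<bullet> (r - p)) / (norm (q - p) * norm (r - p)))"

definition angles_at :: "real ^ 2 \<Rightarrow> (real ^ 2) set \<Rightarrow> real set" where
  "angles_at p P =
     {\<alpha>. 0 < \<alpha> \<and> \<alpha> < pi \<and>
         (\<exists>q r. q \<in> P - {p} \<and> r \<in> P - {p} \<and> q \<noteq> r \<and> \<alpha> = angle_at q p r)}"

definition num_angles_at :: "real ^ 2 \<Rightarrow> (real ^ 2) set \<Rightarrow> nat" where
  "num_angles_at p P = card (angles_at p P)"

definition admissible :: "nat \<Rightarrow> (real ^ 2) set \<Rightarrow> bool" where
  "admissible n P \<longleftrightarrow> finite P \<and> card P = n \<and> \<not> collinear P"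

text \<open>The minimum is over a set of natural numbers that is nonempty for \<open>n \<ge> 3\<close>
  (lemma \<open>admissible_exists\<close>), so that \<open>LEAST\<close> is an attained minimum
  (lemma \<open>A_hat_attained\<close>). For \<open>n < 3\<close> the value is unspecified.\<close>

definition A_hat :: "nat \<Rightarrow> nat" where
  "A_hat n = (LEAST k. \<exists>P. admissible n P \<and> k = (\<Sum>p\<in>P. num_angles_at p P))"

lemma finite_angles_at:
  assumes "finite P"
  shows "finite (angles_at p P)"
proof (rule finite_subset)
  show "angles_at p P \<subseteq> (\<lambda>(q, r). angle_at q p r) ` (P \<times> P)"
    unfolding angles_at_def by auto
  show "finite ((\<lambda>(q, r). angle_at q p r) ` (P \<times> P))"
    using assms by simp
qed

lemma admissible_exists:
  assumes "n \<ge> 3"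
  shows "\<exists>P. admissible n P"
proof -
  define L :: "(real ^ 2) set" where "L = (\<lambda>i. vector [real i, 0]) ` {..<n - 1}"
  define a :: "real ^ 2" where "a = vector [0, 1]"
  have "inj_on (\<lambda>i. vector [real i, 0] :: real ^ 2) {..<n - 1}"
    by (auto simp: inj_on_def vec_eq_iff forall_2)
  then have cL: "card L = n - 1"
    unfolding L_def by (simp add: card_image)
  have aL: "a \<notin> L"
    by (auto simp: L_def a_def vec_eq_iff forall_2)
  have fL: "finite L"
    by (simp add: L_def)
  have "\<not> collinear (insert a L)"
  proof
    assume c: "collinear (insert a L)"
    have "0 = (vector [real 0, 0] :: real ^ 2)"
      by (simp add: vec_eq_iff forall_2)
    moreover have "0 < n - 1"
      using assms by simp
    ultimately have "0 \<in> L"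
      unfolding L_def by (intro image_eqI[of _ _ 0]) simp_all
    moreover have "vector [1, 0] \<in> L"
      unfolding L_def using assms by (intro image_eqI[of _ _ 1]) simp_all
    ultimately have "{0, a, vector [1, 0]} \<subseteq> insert a L"
      by auto
    with c have "collinear {0, a, vector [1, 0]}"
      by (rule collinear_subset)
    then show False
      unfolding collinear_lemma by (auto simp: a_def vec_eq_iff forall_2)
  qed
  then have "admissible n (insert a L)"
    using fL cL aL assms by (simp add: admissible_def)
  then show ?thesis ..
qed

lemma A_hat_attained:
  assumes "n \<ge> 3"
  shows "\<exists>P. admissible n P \<and> A_hat n = (\<Sum>p\<in>P. num_angles_at p P)"
proof -
  have "\<exists>k. \<exists>P. admissible n P \<and> k = (\<Sum>p\<in>P. num_angles_at p P)"
    using admissible_exists[OF assms] by blast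
  then show ?thesis
    unfolding A_hat_def by (rule LeastI_ex)
qed

lemma A_hat_le:
  assumes "admissible n P"
  shows "A_hat n \<le> (\<Sum>p\<in>P. num_angles_at p P)"
  unfolding A_hat_def using assms by (intro Least_le) auto

end

(* Take n - 1 points on a line and one further point, the apex, such that the rays from the
   apex to the points on the line are equally spaced. The apex sees only the n - 2 multiples of
   the spacing. At a point of the line every angle in (0, pi) has one arm through the apex and the
   other along the line, which gives two values at an inner point and one at each of the two end
   points. The total is (n - 2) + 2 (n - 3) + 2 = 3 n - 6. *)

theory Submission
  imports Defs
begin

text \<open>The apex is placed at the origin and the line at abscissa 1, so that the ray from the
  apex with polar angle a in (-pi/2, pi/2) meets the line in \<open>vline (tan a)\<close>.\<close>

definition vline :: "real \<Rightarrow> real ^ 2" where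
  "vline t = vector [1, t]"

lemma vline_eq_iff [simp]: "vline s = vline t \<longleftrightarrow> s = t"
  by (auto simp: vline_def vec_eq_iff forall_2)

lemma vline_neq_0 [simp]: "vline t \<noteq> 0" "0 \<noteq> vline t"
  by (auto simp: vline_def vec_eq_iff forall_2)

lemma inner_vline: "vline s \<bullet> vline t = 1 + s * t"
  by (simp add: vline_def inner_vec_def sum_2)

lemma norm_vline: "norm (vline t) = sqrt (1 + t\<^sup>2)"
  by (simp add: norm_eq_sqrt_inner inner_vline power2_eq_square)

lemma vline_diff: "vline s - vline t = (s - t) *\<^sub>R axis 2 1"
  by (simp add: vline_def vec_eq_iff forall_2 axis_def)

lemma inner_vline_axis: "vline t \<bullet> axis 2 1 = t"
  by (simp add: vline_def inner_axis)

lemma angle_at_commute: "angle_at q p r = angle_at r p q"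
  by (simp add: angle_at_def inner_commute mult.commute)

text \<open>The two points have polar angles \<open>a\<close> and \<open>b\<close>, which differ by
  less than pi, so \<open>arccos\<close> recovers the difference from its cosine.\<close>

lemma angle_at_vline_apex:
  assumes "\<bar>a\<bar> < pi / 2" "\<bar>b\<bar> < pi / 2"
  shows "angle_at (vline (tan a)) 0 (vline (tan b)) = \<bar>a - b\<bar>"
proof -
  have pos: "cos a > 0" "cos b > 0"
    using assms by (auto intro!: cos_gt_zero_pi)
  have nrm: "norm (vline (tan x)) = inverse (cos x)" if "cos x > 0" for x
    using that by (simp add: norm_vline tan_sec real_sqrt_inverse)
  \<comment> \<open>The norms are 1 / cos a and 1 / cos b, so normalising the inner product
    multiplies it by cos a * cos b.\<close>
  have "(1 + tan a * tan b) * (cos a * cos b) = cos (a - b)"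
    using pos by (simp add: tan_def cos_diff field_simps)
  then have "angle_at (vline (tan a)) 0 (vline (tan b)) = arccos (cos \<bar>a - b\<bar>)"
    using pos by (simp add: angle_at_def inner_vline nrm divide_inverse)
  also have "\<dots> = \<bar>a - b\<bar>"
    using assms by (intro arccos_cos) auto
  finally show ?thesis .
qed

text \<open>The arm from \<open>vline t\<close> to \<open>vline s\<close> is vertical. Hence
  \<open>s\<close> enters only through the sign of \<open>s - t\<close>, that is, through the side
  of \<open>t\<close> on which it lies.\<close>

lemma angle_at_vline:
  "angle_at 0 (vline t) (vline s) = arccos (- sgn (s - t) * t / sqrt (1 + t\<^sup>2))"
  by (simp add: angle_at_def vline_diff inner_vline_axis norm_vline sgn_div_norm divide_inverse
      mult_ac)

text \<open>Both arms are vertical, so the cosine is a product of two signs. Such angles fall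
  outside (0, pi) and are never counted.\<close>

lemma angle_at_vline_collinear:
  assumes "r \<noteq> t" "s \<noteq> t"
  shows "angle_at (vline r) (vline t) (vline s) \<in> {0, pi}"
proof -
  have "angle_at (vline r) (vline t) (vline s) = arccos (sgn (r - t) * sgn (s - t))"
    by (simp add: angle_at_def vline_diff inner_axis_axis sgn_div_norm divide_inverse mult_ac)
  then show ?thesis
    using assms by (simp add: sgn_real_def)
qed

text \<open>The rays have polar angles 0, d, ..., (m - 1) d, all below pi/2, so every angle counted
  at the apex is k d with 1 \<le> k < m.\<close>

lemma num_angles_at_apex_le:
  assumes "0 < d" "real m * d \<le> pi / 2"
  shows "num_angles_at 0 (insert 0 ((\<lambda>i. vline (tan (real i * d))) ` {..<m})) \<le> m - 1"
    (is "num_angles_at 0 ?P \<le> _")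
proof -
  have bound: "\<bar>real i * d\<bar> < pi / 2" if "i < m" for i
  proof -
    have "real i * d < real m * d"
      using that assms(1) by simp
    moreover have "0 \<le> real i * d"
      using assms(1) by simp
    ultimately show ?thesis
      using assms(2) by linarith
  qed
  have "angles_at 0 ?P \<subseteq> (\<lambda>k. real k * d) ` {1..<m}"
  proof
    fix \<alpha> assume "\<alpha> \<in> angles_at 0 ?P"
    then obtain i j where ij: "i < m" "j < m" and \<alpha>: "0 < \<alpha>"
      "\<alpha> = angle_at (vline (tan (real i * d))) 0 (vline (tan (real j * d)))"
      by (auto simp: angles_at_def)
    then have "\<alpha> = \<bar>real i * d - real j * d\<bar>"
      using bound angle_at_vline_apex by metis
    also have "\<dots> = real (max i j - min i j) * d"
      using assms(1) by (auto simp: max_def min_def abs_if of_nat_diff algebra_simps)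
    finally have *: "\<alpha> = real (max i j - min i j) * d" .
    \<comment> \<open>The case \<open>i = j\<close> would give \<alpha> = 0, which is
      excluded.\<close>
    moreover have "max i j - min i j \<in> {1..<m}"
      using ij \<alpha>(1) unfolding * by (cases "i = j") (auto simp: max_def min_def)
    ultimately show "\<alpha> \<in> (\<lambda>k. real k * d) ` {1..<m}"
      by blast
  qed
  then have "num_angles_at 0 ?P \<le> card ((\<lambda>k. real k * d) ` {1..<m})"
    unfolding num_angles_at_def by (intro card_mono) auto
  also have "\<dots> \<le> m - 1"
    using card_image_le[of "{1..<m}" "\<lambda>k. real k * d"] by simp
  finally show ?thesis .
qed

text \<open>The bound is the number of sides of \<open>t\<close>, below or above, that contain
  another point of \<open>T\<close>: one arm of a counted angle passes through the apex, and the
  side of the other arm determines the angle.\<close>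

lemma num_angles_at_vline_le:
  assumes "finite T"
  shows "num_angles_at (vline t) (insert 0 (vline ` T)) \<le> card ((\<lambda>s. s < t) ` (T - {t}))"
    (is "num_angles_at _ ?P \<le> _")
proof -
  \<comment> \<open>\<open>g True\<close> is the angle between the apex and the points below
    \<open>t\<close>, \<open>g False\<close> that between the apex and the points above.\<close>
  define g where "g b = arccos ((if b then t else - t) / sqrt (1 + t\<^sup>2))" for b
  have g: "angle_at 0 (vline t) (vline s) = g (s < t)" if "s \<noteq> t" for s
    using that by (simp add: angle_at_vline g_def sgn_real_def)
  have "angles_at (vline t) ?P \<subseteq> g ` (\<lambda>s. s < t) ` (T - {t})"
  proof
    fix \<alpha> assume "\<alpha> \<in> angles_at (vline t) ?P"
    then obtain q r where \<alpha>: "0 < \<alpha>" "\<alpha> < pi" "\<alpha> = angle_at q (vline t) r" "q \<noteq> r"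
      and qr: "q \<in> insert 0 (vline ` (T - {t}))" "r \<in> insert 0 (vline ` (T - {t}))"
      by (auto simp: angles_at_def)
    have "q = 0 \<or> r = 0"
      using \<alpha> qr angle_at_vline_collinear by fastforce
    \<comment> \<open>Since q and r are distinct, exactly one of them is the apex; by symmetry it
      may be taken as the first.\<close>
    then obtain s where "s \<in> T - {t}" "\<alpha> = angle_at 0 (vline t) (vline s)"
      using \<alpha>(3,4) qr angle_at_commute by auto
    then show "\<alpha> \<in> g ` (\<lambda>s. s < t) ` (T - {t})"
      using g by auto
  qed
  then have "num_angles_at (vline t) ?P \<le> card (g ` (\<lambda>s. s < t) ` (T - {t}))"
    unfolding num_angles_at_def by (intro card_mono) (use assms in auto)
  also have "\<dots> \<le> card ((\<lambda>s. s < t) ` (T - {t}))"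
    using assms by (intro card_image_le) auto
  finally show ?thesis .
qed

text \<open>As \<open>f\<close> is increasing, the indices 0 and m - 1 belong to the two end points,
  which have neighbours on one side only. They contribute at most 1 each and the m - 2 others at
  most 2 each.\<close>

lemma sum_num_angles_at_vline_le:
  assumes "strict_mono_on {..<m} f" "m \<ge> 2"
  shows "(\<Sum>i<m. num_angles_at (vline (f i)) (insert 0 (vline ` f ` {..<m}))) \<le> 2 * m - 2"
proof -
  have le: "num_angles_at (vline (f i)) (insert 0 (vline ` f ` {..<m}))
      \<le> (if i \<in> {0, m - 1} then 1 else 2)" if "i < m" for i
  proof -
    define B where "B = (\<lambda>s. s < f i) ` (f ` {..<m} - {f i})"
    have *: "num_angles_at (vline (f i)) (insert 0 (vline ` f ` {..<m})) \<le> card B"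
      unfolding B_def by (intro num_angles_at_vline_le) auto
    have less: "f j < f i \<longleftrightarrow> j < i" if "j < m" for j
      using strict_mono_on_less[OF assms(1)] that \<open>i < m\<close> by simp
    have "card B \<le> card (UNIV :: bool set)"
      by (intro card_mono) auto
    moreover have "card B \<le> 1" if "i = 0"
    proof -
      have "B \<subseteq> {False}"
        using less that by (auto simp: B_def)
      then show ?thesis
        using card_mono[of "{False}" B] by simp
    qed
    moreover have "card B \<le> 1" if "i = m - 1"
    proof -
      have "f j < f i" if "j < m" "f j \<noteq> f i" for j
        using less[OF that(1)] that \<open>i = m - 1\<close> by (cases "j = i") auto
      then have "B \<subseteq> {True}"
        by (auto simp: B_def)
      then show ?thesis
        using card_mono[of "{True}" B] by simp
    qed
    ultimately show ?thesis
      using * by auto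
  qed
  have "(\<Sum>i<m. num_angles_at (vline (f i)) (insert 0 (vline ` f ` {..<m})))
      \<le> (\<Sum>i<m. if i \<in> {0, m - 1} then 1 else 2)"
    using le by (intro sum_mono) auto
  also have "\<dots> = card {0, m - 1} + 2 * card ({..<m} - {0, m - 1})"
  proof -
    have "{..<m} \<inter> {0, m - 1} = {0, m - 1}" "{..<m} \<inter> - {0, m - 1} = {..<m} - {0, m - 1}"
      using assms(2) by auto
    then show ?thesis
      by (simp only: sum.If_cases finite_lessThan Collect_mem_eq) simp
  qed
  \<comment> \<open>For m \<ge> 2 the end indices are distinct, so the value is 2 + 2 (m -
    2).\<close>
  also have "\<dots> = 2 * m - 2"
    using assms(2) by (subst card_Diff_subset) auto
  finally show ?thesis .
qed

text \<open>Two distinct points of the vertical line span it, and it misses the origin.\<close>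

lemma not_collinear_apex_vline:
  assumes "s \<in> T" "t \<in> T" "s \<noteq> t"
  shows "\<not> collinear (insert 0 (vline ` T))"
proof
  assume "collinear (insert 0 (vline ` T))"
  then have "collinear {0, vline s, vline t}"
    by (rule collinear_subset) (use assms in auto)
  then show False
    using assms(3) unfolding collinear_lemma
    by (auto simp: vline_def vec_eq_iff forall_2)
qed

theorem theorem4p4:
  fixes n :: nat
  assumes "n \<ge> 3"
  shows "int (A_hat n) \<le> 3 * int n - 6"
proof -
  define m where "m = n - 1"
  have m: "m \<ge> 2" "n = m + 1"
    using assms by (auto simp: m_def)
  \<comment> \<open>With this spacing the m polar angles i d, i < m, lie in [0, pi/2), where tan is
    strictly increasing.\<close>
  define d where "d = pi / (2 * real m)"
  have d: "0 < d" "real m * d = pi / 2"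
    using m by (auto simp: d_def)
  define f where "f i = tan (real i * d)" for i :: nat
  have mono: "strict_mono_on {..<m} f"
  proof (rule strict_mono_onI)
    fix i j assume "i \<in> {..<m}" "j \<in> {..<m}" "i < j"
    then have "real i * d < real j * d" "real j * d < real m * d"
      using d(1) by auto
    moreover have "0 \<le> real i * d"
      using d(1) by simp
    ultimately show "f i < f j"
      unfolding f_def using d(2) pi_gt_zero by (intro tan_monotone) linarith+
  qed
  then have inj: "inj_on f {..<m}"
    by (rule strict_mono_on_imp_inj_on)
  define P where "P = insert 0 (vline ` f ` {..<m})"
  have inj': "inj_on (\<lambda>i. vline (f i)) {..<m}"
    using inj by (auto simp: inj_on_def)
  have "f 0 \<noteq> f 1"
    using inj_on_eq_iff[OF inj, of 0 1] m(1) by simp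
  then have "\<not> collinear P"
    unfolding P_def using m(1) by (intro not_collinear_apex_vline[of "f 0" _ "f 1"]) auto
  moreover have "card P = n"
    unfolding P_def using inj' m(2)
    by (subst card_insert_disjoint) (auto simp: image_image card_image)
  ultimately have "admissible n P"
    by (simp add: admissible_def P_def)
  then have "A_hat n \<le> (\<Sum>p\<in>P. num_angles_at p P)"
    by (rule A_hat_le)
  also have "\<dots> = num_angles_at 0 P + (\<Sum>p\<in>vline ` f ` {..<m}. num_angles_at p P)"
    by (subst P_def, subst sum.insert) auto
  also have "(\<Sum>p\<in>vline ` f ` {..<m}. num_angles_at p P)
      = (\<Sum>i<m. num_angles_at (vline (f i)) P)"
    using sum.reindex[OF inj', of "\<lambda>p. num_angles_at p P"] by (simp add: image_image)
  also have "(\<Sum>i<m. num_angles_at (vline (f i)) P) \<le> 2 * m - 2"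
    unfolding P_def using mono m(1) by (rule sum_num_angles_at_vline_le)
  also have "num_angles_at 0 P \<le> m - 1"
    using num_angles_at_apex_le[OF d(1), of m] d(2) by (simp add: P_def f_def image_image)
  finally have "A_hat n \<le> (m - 1) + (2 * m - 2)"
    by simp
  \<comment> \<open>The natural subtractions are exact as m \<ge> 2, and 3 m - 3 = 3 n - 6 because n
    = m + 1.\<close>
  then show ?thesis
    using m by simp
qed

end
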